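(* Let $T\ge 1$ be an integer, $0<\alpha<1$, $0<\rho<1$, $0<\lambda\le 1$ and $\sigma\ge 0$. Consider the problem of maximizing the normalized secondary throughput $\mathcal W_S(\underline\kappa)$ over all policies $\underline\kappa=(\kappa_0,\dots,\kappa_T)\in[0,1]^{T+1}$ subject to the primary throughput-loss constraint $\mathcal J_P(\underline\kappa)-\mathcal J_P(\underline 0)\le\sigma$. Then the optimal policy $\widehat{\underline\kappa}$ of this problem has the structure $$\widehat{\underline\kappa}=[\,\underline 1_{N_1},\ \kappa_{N_1},\ \underline 0_{N_0}\,],\qquad 0\le\kappa_{N_1}\le 1,$$ where $N_1,N_0\ge 0$ are integers with $N_1+1+N_0=T+1$; that is, $\widehat\kappa_\theta=1$ for $0\le\theta<N_1$, $\widehat\kappa_{N_1}=\kappa_{N_1}\in[0,1]$, and $\widehat\kappa_\theta=0$ for $N_1<\theta\le T$.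
   Context: A primary source transmits each packet at most $T$ times; in a slot in which no retransmission is scheduled it sends a fresh packet with probability $\alpha$. State $0$ means the primary source is idle; state $\theta\in\{1,\dots,T\}$ means that it is performing the $\theta$-th transmission of a packet. A policy of the secondary source is a vector $\underline\kappa=(\kappa_0,\dots,\kappa_T)\in[0,1]^{T+1}$, where $\kappa_\theta$ is the probability that the secondary source transmits in state $\theta$. The failure probability of the primary transmission in state $\theta\ge1$ is $\rho_\theta=\rho+(1-\rho)\lambda\kappa_\theta$; here $\rho$ is the failure probability without secondary transmission and $\rho^*=\rho+(1-\rho)\lambda$ that with secondary transmission. The failure probability at the secondary receiver does not depend on the primary's activity, and the secondary throughput is normalized by the corresponding success probability. Packet size over slot duration is normalized to $1$. With $\mathcal D(\underline\kappa)=1+\alpha\sum_{t=1}^{T-1}\prod_{i=1}^{t}\rho_i$, the long-run average cost of the primary source (one minus its throughput) and the normalized long-run throughput of the secondary source (the stationary fraction of slots in which it transmits) are $$\mathcal J_P(\underline\kappa)=\frac{(1-\alpha)+\alpha\sum_{t=1}^{T}\prod_{i=1}^{t}\rho_i}{\mathcal D(\underline\kappa)},\qquad \mathcal W_S(\underline\kappa)=\frac{(1-\alpha)\kappa_0+\alpha\sum_{t=1}^{T}\kappa_t\prod_{i=1}^{t-1}\rho_i}{\mathcal D(\underline\kappa)}.$$ Empty products equal $1$, empty sums equal $0$. $\underline 0$ is the all-zero policy; $\underline 1_{n}$ and $\underline 0_{n}$ denote vectors of $n$ ones and $n$ zeros. *)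

theory Defs
  imports Complex_Main "HOL-Library.FuncSet"
begin

text \<open>
  A policy is a function on \<open>nat\<close> of which only the values on the states \<open>0, \<dots>, T\<close> matter.
  The symbol \<open>\<lambda>\<close> of the model is written \<open>lam\<close>.
\<close>

definition policies :: "nat \<Rightarrow> (nat \<Rightarrow> real) set" where
  "policies T = {0..T} \<rightarrow> {0..1}"

definition fail_prob :: "real \<Rightarrow> real \<Rightarrow> (nat \<Rightarrow> real) \<Rightarrow> nat \<Rightarrow> real" where
  "fail_prob \<rho> lam \<kappa> \<theta> = \<rho> + (1 - \<rho>) * lam * \<kappa> \<theta>"

text \<open>
  Mean length of a renewal cycle: with probability \<open>1 - \<alpha>\<close> one idle slot, with probability \<open>\<alpha>\<close>
  the transmissions \<open>1, \<dots>, T\<close> of one packet, of which transmission \<open>t + 1\<close> takes place iff the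
  first \<open>t\<close> fail. The two quotients below are therefore long-run averages per slot.
\<close>

definition mean_cycle :: "nat \<Rightarrow> real \<Rightarrow> real \<Rightarrow> real \<Rightarrow> (nat \<Rightarrow> real) \<Rightarrow> real" where
  "mean_cycle T \<alpha> \<rho> lam \<kappa> =
     1 + \<alpha> * (\<Sum>t = 1..T - 1. \<Prod>i = 1..t. fail_prob \<rho> lam \<kappa> i)"

definition primary_cost :: "nat \<Rightarrow> real \<Rightarrow> real \<Rightarrow> real \<Rightarrow> (nat \<Rightarrow> real) \<Rightarrow> real" where
  "primary_cost T \<alpha> \<rho> lam \<kappa> =
     ((1 - \<alpha>) + \<alpha> * (\<Sum>t = 1..T. \<Prod>i = 1..t. fail_prob \<rho> lam \<kappa> i))
       / mean_cycle T \<alpha> \<rho> lam \<kappa>"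

definition secondary_throughput :: "nat \<Rightarrow> real \<Rightarrow> real \<Rightarrow> real \<Rightarrow> (nat \<Rightarrow> real) \<Rightarrow> real" where
  "secondary_throughput T \<alpha> \<rho> lam \<kappa> =
     ((1 - \<alpha>) * \<kappa> 0 + \<alpha> * (\<Sum>t = 1..T. \<kappa> t * (\<Prod>i = 1..t - 1. fail_prob \<rho> lam \<kappa> i)))
       / mean_cycle T \<alpha> \<rho> lam \<kappa>"

definition feasible :: "nat \<Rightarrow> real \<Rightarrow> real \<Rightarrow> real \<Rightarrow> real \<Rightarrow> (nat \<Rightarrow> real) \<Rightarrow> bool" where
  "feasible T \<alpha> \<rho> lam \<sigma> \<kappa> \<longleftrightarrow>
     \<kappa> \<in> policies T \<and>
     primary_cost T \<alpha> \<rho> lam \<kappa> - primary_cost T \<alpha> \<rho> lam (\<lambda>_. 0) \<le> \<sigma>"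

definition optimal_policy :: "nat \<Rightarrow> real \<Rightarrow> real \<Rightarrow> real \<Rightarrow> real \<Rightarrow> (nat \<Rightarrow> real) \<Rightarrow> bool" where
  "optimal_policy T \<alpha> \<rho> lam \<sigma> \<kappa> \<longleftrightarrow>
     is_arg_max (secondary_throughput T \<alpha> \<rho> lam) (feasible T \<alpha> \<rho> lam \<sigma>) \<kappa>"

definition threshold_structure :: "nat \<Rightarrow> (nat \<Rightarrow> real) \<Rightarrow> bool" where
  "threshold_structure T \<kappa> \<longleftrightarrow>
     (\<exists>N\<^sub>1 N\<^sub>0 k. N\<^sub>1 + 1 + N\<^sub>0 = T + 1 \<and> 0 \<le> k \<and> k \<le> 1 \<and>
        (\<forall>\<theta><N\<^sub>1. \<kappa> \<theta> = 1) \<and> \<kappa> N\<^sub>1 = k \<and> (\<forall>\<theta>. N\<^sub>1 < \<theta> \<and> \<theta> \<le> T \<longrightarrow> \<kappa> \<theta> = 0))"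

end

theory Submission
  imports Defs "HOL-Analysis.Function_Topology"
begin

text \<open>
  Writing \<open>D\<close> for the mean cycle length, \<open>J\<close> for the primary cost and \<open>W\<close> for the secondary
  throughput, \<open>W = 1 / lam + (1 - \<alpha>) * (\<kappa> 0 - 1 / lam) / D - (1 - J) / ((1 - \<rho>) * lam)\<close>.
  Hence \<open>\<kappa> 0 = 1\<close> at an optimum, and then, for fixed \<open>J\<close>, a larger \<open>D\<close> is never worse and is
  strictly better if \<open>lam < 1\<close>. If a policy is not of threshold form, some consecutive states
  \<open>i, i + 1\<close> have \<open>\<kappa> i < 1\<close> and \<open>\<kappa> (i + 1) > 0\<close>; shifting transmission probability from
  \<open>i + 1\<close> to \<open>i\<close> so that \<open>J\<close> is unchanged strictly increases \<open>D\<close>. By compactness there is an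
  optimal policy with the largest \<open>D\<close> among all optimal ones, and it must be of threshold form.
\<close>

section \<open>Maxima with tie-breaking on compact sets\<close>

text \<open>The maximizers of \<open>f\<close> form a closed, hence compact, subset of
  \<open>K\<close>; any maximizer of \<open>g\<close> on it will do. Applied below with throughput
  as \<open>f\<close> and cycle length as \<open>g\<close>.\<close>

lemma lexicographic_maximum_exists:
  fixes f g :: "'a::topological_space \<Rightarrow> real"
  assumes "compact K" "K \<noteq> {}" and f: "continuous_on K f" and g: "continuous_on K g"
  obtains x where "x \<in> K" "\<And>y. y \<in> K \<Longrightarrow> f y \<le> f x"
    "\<And>y. y \<in> K \<Longrightarrow> f y = f x \<Longrightarrow> g y \<le> g x"
proof -
  obtain x0 where x0: "x0 \<in> K" "\<And>y. y \<in> K \<Longrightarrow> f y \<le> f x0"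
    using continuous_attains_sup[OF assms(1,2) f] by auto
  define L where "L = {x \<in> K. f x = f x0}"
  have "closedin (top_of_set K) L"
    unfolding L_def using f by (rule continuous_closedin_preimage_constant)
  then have "compact L"
    using assms(1) closedin_compact by blast
  moreover have "L \<noteq> {}"
    using x0 by (auto simp: L_def)
  moreover have "continuous_on L g"
    using g by (rule continuous_on_subset) (auto simp: L_def)
  ultimately obtain x where "x \<in> L" "\<And>y. y \<in> L \<Longrightarrow> g y \<le> g x"
    using continuous_attains_sup[of L g] by auto
  with x0 show ?thesis
    by (intro that[of x]) (auto simp: L_def)
qed

section \<open>Exchange between two consecutive factors\<close>

text \<open>A product of length below \<open>i\<close> contains neither altered factor, the one of
  length \<open>i\<close> only the first, every longer one both. Hence the ratio \<open>q\<close> of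
  the pair rescales all longer products alike.\<close>

lemma prod_update_adjacent:
  fixes r r' :: "nat \<Rightarrow> real"
  assumes i: "1 \<le> i" and other: "\<And>j. j \<noteq> i \<Longrightarrow> j \<noteq> Suc i \<Longrightarrow> r' j = r j"
  shows "t < i \<Longrightarrow> (\<Prod>j = 1..t. r' j) = (\<Prod>j = 1..t. r j)"
    and "(\<Prod>j = 1..i. r' j) = (\<Prod>j = 1..i - 1. r j) * r' i"
    and "r' i * r' (Suc i) = q * (r i * r (Suc i)) \<Longrightarrow> i < t \<Longrightarrow>
           (\<Prod>j = 1..t. r' j) = q * (\<Prod>j = 1..t. r j)"
proof -
  show below: "(\<Prod>j = 1..t. r' j) = (\<Prod>j = 1..t. r j)" if "t < i" for t
    using that by (intro prod.cong) (auto intro!: other)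
  obtain m where m: "i = Suc m"
    using i by (cases i) auto
  show at: "(\<Prod>j = 1..i. r' j) = (\<Prod>j = 1..i - 1. r j) * r' i"
    using below[of m] by (simp add: m)
  show "(\<Prod>j = 1..t. r' j) = q * (\<Prod>j = 1..t. r j)"
    if q: "r' i * r' (Suc i) = q * (r i * r (Suc i))" and "i < t"
  proof -
    from \<open>i < t\<close> have "Suc i \<le> t" by simp
    then show ?thesis
    proof (induction t rule: dec_induct)
      case base
      have "(\<Prod>j = 1..Suc i. r' j) = (\<Prod>j = 1..i - 1. r j) * (r' i * r' (Suc i))"
        using at by simp
      also have "\<dots> = q * (\<Prod>j = 1..Suc i. r j)"
        unfolding q by (simp add: m)
      finally show ?case .
    next
      case (step n)
      then show ?case
        using other[of "Suc n"] by simp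
    qed
  qed
qed

text \<open>
  Raising \<open>r i\<close> by \<open>\<delta>\<close> while lowering \<open>r (Suc i)\<close> so that all later products shrink by \<open>1 - \<eta>\<close>
  changes the sum by \<open>A \<delta> - \<eta> B\<close> and the last product \<open>C\<close> by \<open>- \<eta> C\<close>; the quotient stays fixed
  iff \<open>\<eta> = x A \<delta> / (C + x B)\<close>.
\<close>
lemma exchange_adjacent:
  fixes r :: "nat \<Rightarrow> real"
  assumes pos: "\<And>j. 0 < r j" and r1: "\<And>j. 1 \<le> j \<Longrightarrow> j \<le> T \<Longrightarrow> r j \<le> 1"
    and i: "1 \<le> i" "i < T" and ri: "r i < b" "b \<le> 1" and rSi: "a < r (Suc i)" and "0 < \<beta>"
  obtains r' where "\<And>j. j \<noteq> i \<Longrightarrow> j \<noteq> Suc i \<Longrightarrow> r' j = r j"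
    "r i \<le> r' i" "r' i \<le> b" "a \<le> r' (Suc i)" "r' (Suc i) \<le> r (Suc i)"
    "(\<Sum>t<T. \<Prod>j = 1..t. r j) < (\<Sum>t<T. \<Prod>j = 1..t. r' j)"
    "(1 - (\<Prod>j = 1..T. r' j)) / (\<beta> + (\<Sum>t<T. \<Prod>j = 1..t. r' j)) =
     (1 - (\<Prod>j = 1..T. r j)) / (\<beta> + (\<Sum>t<T. \<Prod>j = 1..t. r j))"
proof -
  define P where "P t = (\<Prod>j = 1..t. r j)" for t
  have Ppos: "0 < P t" for t
    unfolding P_def by (intro prod_pos) (auto simp: pos)
  define A B C S where "A = P (i - 1)" and "B = (\<Sum>t = Suc i..<T. P t)" and "C = P T"
    and "S = (\<Sum>t<T. P t)"
  define x where "x = (1 - C) / (\<beta> + S)"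
  have "A > 0" "C > 0" "B \<ge> 0" "S \<ge> 0"
    unfolding A_def B_def C_def S_def by (auto intro!: sum_nonneg simp: Ppos less_imp_le)
  \<comment> \<open>The other factors of the last product are at most 1, so \<open>r i < b\<close>
    and \<open>b <= 1\<close> force \<open>C < 1\<close>. Thus \<open>x > 0\<close>, which later
    gives \<eta> >= 0 and so keeps \<open>new\<close> below \<open>r (Suc i)\<close>.\<close>
  have "C \<le> r i"
  proof -
    have "C = r i * (\<Prod>j \<in> {1..T} - {i}. r j)"
      unfolding C_def P_def using i by (subst prod.remove[of _ i]) auto
    also have "\<dots> \<le> r i * 1"
      by (intro mult_left_mono prod_le_1) (auto simp: pos less_imp_le r1)
    finally show ?thesis by simp
  qed
  then have "C < 1"
    using ri by linarith
  then have "0 < x"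
    unfolding x_def using \<open>0 < \<beta>\<close> \<open>S \<ge> 0\<close> by (intro divide_pos_pos add_pos_nonneg) auto
  then have den: "0 < C + x * B"
    using \<open>C > 0\<close> \<open>B \<ge> 0\<close> by (intro add_pos_nonneg) auto
  define \<eta> where "\<eta> \<delta> = x * A * \<delta> / (C + x * B)" for \<delta>
  \<comment> \<open>Solves \<open>(r i + \<delta>) * new \<delta> = (1 - \<eta> \<delta>) * r i * r
    (Suc i)\<close>.\<close>
  define new where "new \<delta> = r (Suc i) * (1 - \<eta> \<delta>) * r i / (r i + \<delta>)" for \<delta>
  \<comment> \<open>Since \<open>new\<close> tends to \<open>r (Suc i) > a\<close> and
    \<open>r i < b\<close>, a small positive \<delta> respects both bounds.\<close>
  have "(new \<longlongrightarrow> r (Suc i) * (1 - x * A * 0 / (C + x * B)) * r i / (r i + 0)) (at_right 0)"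
    unfolding new_def \<eta>_def using den pos[of i] by (intro tendsto_intros) auto
  then have "(new \<longlongrightarrow> r (Suc i)) (at_right 0)"
    using pos[of i] by simp
  then have "\<forall>\<^sub>F \<delta> in at_right 0. a < new \<delta>"
    using rSi by (rule order_tendstoD)
  moreover have "\<forall>\<^sub>F \<delta> in at_right 0. \<delta> \<in> {0<..<b - r i}"
    using ri by (intro eventually_at_right_real) auto
  ultimately have "\<forall>\<^sub>F \<delta> in at_right 0. a < new \<delta> \<and> \<delta> \<in> {0<..<b - r i}"
    by (rule eventually_conj)
  then have "\<exists>\<delta>. a < new \<delta> \<and> \<delta> \<in> {0<..<b - r i}"
    by (rule eventually_happens'[OF trivial_limit_at_right_real])
  then obtain \<delta> where \<delta>: "a < new \<delta>" "0 < \<delta>" "\<delta> < b - r i"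
    by auto
  define r' where "r' = r(i := r i + \<delta>, Suc i := new \<delta>)"
  have other: "r' j = r j" if "j \<noteq> i" "j \<noteq> Suc i" for j
    using that by (simp add: r'_def)
  have r'i: "r' i = r i + \<delta>" "r' (Suc i) = new \<delta>"
    by (simp_all add: r'_def)
  have q: "r' i * r' (Suc i) = (1 - \<eta> \<delta>) * (r i * r (Suc i))"
    unfolding r'i new_def using pos[of i] \<delta> by (simp add: field_simps)
  define P' where "P' t = (\<Prod>j = 1..t. r' j)" for t
  have P'_below: "P' t = P t" if "t < i" for t
    using prod_update_adjacent(1)[OF i(1) other that] by (simp add: P'_def P_def)
  have P'_above: "P' t = (1 - \<eta> \<delta>) * P t" if "i < t" for t
    using prod_update_adjacent(3)[OF i(1) other q that] by (simp add: P'_def P_def)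
  have P_i: "P i = A * r i"
    unfolding P_def A_def using i by (cases i) auto
  have P'_i: "P' i = A * (r i + \<delta>)"
    using prod_update_adjacent(2)[OF i(1) other] by (simp add: P'_def P_def A_def r'i)
  have split: "(\<Sum>t<T. f t) = (\<Sum>t<i. f t) + f i + (\<Sum>t = Suc i..<T. f t)" for f :: "nat \<Rightarrow> real"
  proof -
    have "(\<Sum>t<T. f t) = (\<Sum>t<i. f t) + (\<Sum>t = i..<T. f t)"
      using i sum.atLeastLessThan_concat[of 0 i T f] by (simp add: lessThan_atLeast0)
    also have "(\<Sum>t = i..<T. f t) = f i + (\<Sum>t = Suc i..<T. f t)"
      using i by (simp add: sum.atLeast_Suc_lessThan)
    finally show ?thesis by simp
  qed
  have "(\<Sum>t<T. P' t) = (\<Sum>t<i. P t) + A * (r i + \<delta>) + (1 - \<eta> \<delta>) * B"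
    unfolding split[of P'] P'_i B_def by (simp add: P'_below P'_above sum_distrib_left)
  moreover have "S = (\<Sum>t<i. P t) + A * r i + B"
    unfolding S_def split[of P] P_i B_def by simp
  ultimately have S': "(\<Sum>t<T. P' t) = S + A * \<delta> - \<eta> \<delta> * B"
    by (simp add: algebra_simps)
  have eta: "\<eta> \<delta> * (C + x * B) = x * A * \<delta>"
    unfolding \<eta>_def using den by simp
  have "0 \<le> \<eta> \<delta>"
    unfolding \<eta>_def using \<open>0 < x\<close> \<open>A > 0\<close> \<delta> den by simp
  \<comment> \<open>The gain at length \<open>i\<close> exceeds the loss at the longer products
    because the net change is \<open>A * \<delta> * C / (C + x * B)\<close> with
    \<open>C > 0\<close>.\<close>
  have "(A * \<delta> - \<eta> \<delta> * B) * (C + x * B) = A * \<delta> * C"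
    using eta by (simp add: algebra_simps) (metis (no_types) distrib_left mult.left_commute)
  then have "0 < A * \<delta> - \<eta> \<delta> * B"
    using den \<open>A > 0\<close> \<open>C > 0\<close> \<delta> by (metis mult_pos_pos zero_less_mult_pos2)
  then have Sless: "S < (\<Sum>t<T. P' t)"
    unfolding S' by simp
  \<comment> \<open>By \<open>eta\<close>, the numerator grows by
    \<open>\<eta> \<delta> * C\<close>, which is \<open>x\<close> times the growth of the
    denominator.\<close>
  have "x * (\<beta> + S) = 1 - C"
    unfolding x_def using \<open>0 < \<beta>\<close> \<open>S \<ge> 0\<close> by simp
  then have "1 - P' T = x * (\<beta> + (\<Sum>t<T. P' t))"
    using eta P'_above[of T] i unfolding S' C_def[symmetric] by (simp add: algebra_simps)
  then have quot: "(1 - P' T) / (\<beta> + (\<Sum>t<T. P' t)) = x"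
    using Sless \<open>0 < \<beta>\<close> \<open>S \<ge> 0\<close> by simp
  have "new \<delta> \<le> r (Suc i)"
  proof -
    have "(1 - \<eta> \<delta>) * r i \<le> 1 * r i"
      using \<open>0 \<le> \<eta> \<delta>\<close> pos[of i] by (intro mult_right_mono) auto
    then have "(1 - \<eta> \<delta>) * r i \<le> r i + \<delta>"
      using \<delta> by simp
    then have "(1 - \<eta> \<delta>) * r i / (r i + \<delta>) \<le> 1"
      using pos[of i] \<delta> by simp
    then have "r (Suc i) * ((1 - \<eta> \<delta>) * r i / (r i + \<delta>)) \<le> r (Suc i) * 1"
      using pos[of "Suc i"] by (intro mult_left_mono) auto
    then show ?thesis
      by (simp add: new_def mult.assoc)
  qed
  with \<delta> other Sless quot show ?thesis
    by (intro that[of r']) (auto simp: r'i P'_def P_def S_def x_def C_def)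
qed

section \<open>Cycle length, cost and throughput through products of failure probabilities\<close>

context
  fixes T :: nat and \<alpha> \<rho> lam :: real
  assumes T: "T \<ge> 1" and \<alpha>: "0 < \<alpha>" "\<alpha> < 1" and \<rho>: "0 < \<rho>" "\<rho> < 1"
    and lam: "0 < lam" "lam \<le> 1"
begin

abbreviation "r \<equiv> fail_prob \<rho> lam"
abbreviation "run \<equiv> \<lambda>\<kappa> t. \<Prod>i = 1..t. r \<kappa> i"
abbreviation "D \<equiv> mean_cycle T \<alpha> \<rho> lam"
abbreviation "J \<equiv> primary_cost T \<alpha> \<rho> lam"
abbreviation "W \<equiv> secondary_throughput T \<alpha> \<rho> lam"

lemma fail_prob_bounds:
  assumes "\<kappa> \<in> policies T" "j \<le> T"
  shows "\<rho> \<le> r \<kappa> j" "r \<kappa> j \<le> \<rho> + (1 - \<rho>) * lam" "r \<kappa> j \<le> 1"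
proof -
  have k: "0 \<le> \<kappa> j" "\<kappa> j \<le> 1"
    using assms by (auto simp: policies_def)
  then show "\<rho> \<le> r \<kappa> j"
    using \<rho> lam by (simp add: fail_prob_def)
  have "(1 - \<rho>) * lam * \<kappa> j \<le> (1 - \<rho>) * lam * 1"
    using k \<rho> lam by (intro mult_left_mono) auto
  then show *: "r \<kappa> j \<le> \<rho> + (1 - \<rho>) * lam"
    by (simp add: fail_prob_def)
  have "(1 - \<rho>) * lam \<le> (1 - \<rho>) * 1"
    using \<rho> lam by (intro mult_left_mono) auto
  with * show "r \<kappa> j \<le> 1" by simp
qed

text \<open>Splitting 1 as (1 - \<alpha>) + \<alpha> turns the second summand into the empty product
  at \<open>t = 0\<close>. This exposes \<open>(1 - \<alpha>) / \<alpha>\<close> as the \<beta> of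
  \<open>exchange_adjacent\<close>.\<close>

lemma mean_cycle_eq: "D \<kappa> = \<alpha> * ((1 - \<alpha>) / \<alpha> + (\<Sum>t<T. run \<kappa> t))"
proof -
  have "{..<T} = insert 0 {1..T - 1}"
    using T by auto
  then have "(\<Sum>t<T. run \<kappa> t) = 1 + (\<Sum>t = 1..T - 1. run \<kappa> t)"
    by simp
  then show ?thesis
    using \<alpha> by (simp add: mean_cycle_def field_simps)
qed

lemma mean_cycle_pos:
  assumes "\<kappa> \<in> policies T"
  shows "0 < D \<kappa>"
proof -
  have "0 \<le> r \<kappa> j" if "j \<le> T" for j
    using fail_prob_bounds(1)[OF assms that] \<rho> by linarith
  then have "0 \<le> run \<kappa> t" if "t \<le> T" for t
    using that by (intro prod_nonneg) auto
  then have "0 \<le> (\<Sum>t<T. run \<kappa> t)"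
    by (intro sum_nonneg) auto
  then show ?thesis
    unfolding mean_cycle_eq using \<alpha> by (intro mult_pos_pos add_pos_nonneg) auto
qed

lemma sum_run_shift: "(\<Sum>t = 1..T. run \<kappa> (t - 1)) = (\<Sum>t<T. run \<kappa> t)"
  by (rule sum.reindex_bij_witness[where i = Suc and j = "\<lambda>t. t - 1"]) auto

lemma sum_run_atMost: "(\<Sum>t = 1..T. run \<kappa> t) = (\<Sum>t<T. run \<kappa> t) - 1 + run \<kappa> T"
proof -
  have "(\<Sum>t\<le>T. run \<kappa> t) = (\<Sum>t<T. run \<kappa> t) + run \<kappa> T"
    by (simp add: lessThan_Suc_atMost[symmetric])
  moreover have "{..T} = insert 0 {1..T}"
    by auto
  then have "(\<Sum>t\<le>T. run \<kappa> t) = 1 + (\<Sum>t = 1..T. run \<kappa> t)"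
    by simp
  ultimately show ?thesis by simp
qed

text \<open>The numerator of the cost is
  \<open>D \<kappa> - \<alpha> * (1 - run \<kappa> T)\<close>. So \<open>1 - J \<kappa>\<close> is
  the quotient that \<open>exchange_adjacent\<close> preserves.\<close>

lemma primary_cost_eq:
  assumes "\<kappa> \<in> policies T"
  shows "J \<kappa> = 1 - (1 - run \<kappa> T) / ((1 - \<alpha>) / \<alpha> + (\<Sum>t<T. run \<kappa> t))"
  using mean_cycle_pos[OF assms] \<alpha>
  unfolding primary_cost_def sum_run_atMost mean_cycle_eq
  by (simp add: divide_simps) (simp add: algebra_simps)

text \<open>
  Since \<open>(1 - \<rho>) * lam * \<kappa> t = r \<kappa> t - \<rho>\<close>, the throughput depends on \<open>\<kappa>\<close> only through
  \<open>\<kappa> 0\<close>, the mean cycle length and the primary cost.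
\<close>
lemma secondary_throughput_eq:
  assumes "\<kappa> \<in> policies T"
  shows "W \<kappa> = 1 / lam + (1 - \<alpha>) * (\<kappa> 0 - 1 / lam) / D \<kappa> - (1 - J \<kappa>) / ((1 - \<rho>) * lam)"
proof -
  define c where "c = (1 - \<rho>) * lam"
  have c: "c > 0"
    unfolding c_def using \<rho> lam by simp
  define S p where "S = (\<Sum>t<T. run \<kappa> t)" and "p = run \<kappa> T"
  have D: "D \<kappa> = 1 - \<alpha> + \<alpha> * S" "D \<kappa> > 0"
    using mean_cycle_pos[OF assms] \<alpha> unfolding mean_cycle_eq S_def by (auto simp: field_simps)
  have J: "1 - J \<kappa> = \<alpha> * (1 - p) / D \<kappa>"
    using D(2) \<alpha> unfolding primary_cost_eq[OF assms] mean_cycle_eq p_def S_def[symmetric]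
    by (simp add: divide_simps)
  have "c * (\<Sum>t = 1..T. \<kappa> t * run \<kappa> (t - 1)) = (\<Sum>t = 1..T. run \<kappa> t - \<rho> * run \<kappa> (t - 1))"
    unfolding sum_distrib_left
  proof (intro sum.cong refl)
    fix t assume "t \<in> {1..T}"
    then obtain m where "t = Suc m" by (cases t) auto
    then show "c * (\<kappa> t * run \<kappa> (t - 1)) = run \<kappa> t - \<rho> * run \<kappa> (t - 1)"
      by (simp add: c_def fail_prob_def algebra_simps)
  qed
  also have "\<dots> = (S - 1 + p) - \<rho> * S"
    unfolding sum_subtractf sum_distrib_left[symmetric] sum_run_shift sum_run_atMost S_def p_def ..
  finally have "(\<Sum>t = 1..T. \<kappa> t * run \<kappa> (t - 1)) = ((1 - \<rho>) * S - (1 - p)) / c"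
    using c by (simp add: field_simps)
  then have "W \<kappa> = ((1 - \<alpha>) * \<kappa> 0 + \<alpha> * (((1 - \<rho>) * S - (1 - p)) / c)) / D \<kappa>"
    by (simp add: secondary_throughput_def)
  also have "((1 - \<rho>) * S - (1 - p)) / c = S / lam - (1 - p) / c"
    using \<rho> lam by (simp add: c_def diff_divide_distrib)
  also have "((1 - \<alpha>) * \<kappa> 0 + \<alpha> * (S / lam - (1 - p) / c)) / D \<kappa> =
      ((1 - \<alpha>) * \<kappa> 0 + \<alpha> * S / lam - \<alpha> * (1 - p) / c) / D \<kappa>"
    by (simp add: right_diff_distrib)
  also have "\<alpha> * S = D \<kappa> - (1 - \<alpha>)"
    using D by simp
  also have "((1 - \<alpha>) * \<kappa> 0 + (D \<kappa> - (1 - \<alpha>)) / lam - \<alpha> * (1 - p) / c) / D \<kappa> =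
      1 / lam + (1 - \<alpha>) * (\<kappa> 0 - 1 / lam) / D \<kappa> - \<alpha> * (1 - p) / D \<kappa> / c"
    using D(2) c lam by (simp add: field_simps)
  finally show ?thesis
    by (simp add: J c_def)
qed

lemma policy_cong:
  assumes "\<And>j. j \<le> T \<Longrightarrow> \<kappa>' j = \<kappa> j"
  shows "D \<kappa>' = D \<kappa>" "J \<kappa>' = J \<kappa>" "W \<kappa>' = W \<kappa>"
    "feasible T \<alpha> \<rho> lam \<sigma> \<kappa>' \<longleftrightarrow> feasible T \<alpha> \<rho> lam \<sigma> \<kappa>"
proof -
  have run: "run \<kappa>' t = run \<kappa> t" if "t \<le> T" for t
    using that assms by (intro prod.cong) (auto simp: fail_prob_def)
  have sum_run: "(\<Sum>t = 1..n. run \<kappa>' t) = (\<Sum>t = 1..n. run \<kappa> t)" if "n \<le> T" for n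
    using that by (intro sum.cong refl run) auto
  show D: "D \<kappa>' = D \<kappa>"
    unfolding mean_cycle_def by (subst sum_run) auto
  show J: "J \<kappa>' = J \<kappa>"
    unfolding primary_cost_def D by (subst sum_run) auto
  have "(\<Sum>t = 1..T. \<kappa>' t * run \<kappa>' (t - 1)) = (\<Sum>t = 1..T. \<kappa> t * run \<kappa> (t - 1))"
    by (intro sum.cong refl arg_cong2[where f = "(*)"] run assms) auto
  then show "W \<kappa>' = W \<kappa>"
    unfolding secondary_throughput_def D by (simp only: assms le0)
  show "feasible T \<alpha> \<rho> lam \<sigma> \<kappa>' \<longleftrightarrow> feasible T \<alpha> \<rho> lam \<sigma> \<kappa>"
    by (simp add: feasible_def J policies_def Pi_def assms)
qed

section \<open>The idle state, threshold form and improvement at equal cost\<close>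

text \<open>The products start at state 1, so raising \<open>\<kappa> 0\<close> changes neither
  \<open>D\<close> nor \<open>J\<close>, while the throughput strictly increases.\<close>

lemma optimal_policy_idle:
  assumes opt: "optimal_policy T \<alpha> \<rho> lam \<sigma> \<kappa>"
  shows "\<kappa> 0 = 1"
proof (rule ccontr)
  assume "\<kappa> 0 \<noteq> 1"
  have feas: "feasible T \<alpha> \<rho> lam \<sigma> \<kappa>" and pol: "\<kappa> \<in> policies T"
    using opt by (auto simp: optimal_policy_def is_arg_max_def feasible_def)
  then have "\<kappa> 0 < 1"
    using \<open>\<kappa> 0 \<noteq> 1\<close> by (force simp: policies_def Pi_def)
  define \<kappa>' where "\<kappa>' = \<kappa>(0 := 1)"
  have run: "run \<kappa>' t = run \<kappa> t" for t
    by (intro prod.cong) (auto simp: fail_prob_def \<kappa>'_def)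
  have pol': "\<kappa>' \<in> policies T"
    using pol by (auto simp: policies_def \<kappa>'_def)
  have D: "D \<kappa>' = D \<kappa>"
    unfolding mean_cycle_def using run by simp
  have J: "J \<kappa>' = J \<kappa>"
    unfolding primary_cost_def D using run by simp
  have "(1 - \<alpha>) * (\<kappa> 0 - 1 / lam) < (1 - \<alpha>) * (\<kappa>' 0 - 1 / lam)"
    using \<alpha> \<open>\<kappa> 0 < 1\<close> by (intro mult_strict_left_mono) (auto simp: \<kappa>'_def)
  then have "W \<kappa> < W \<kappa>'"
    unfolding secondary_throughput_eq[OF pol] secondary_throughput_eq[OF pol'] D J
    using mean_cycle_pos[OF pol] by (simp add: divide_strict_right_mono)
  moreover have "feasible T \<alpha> \<rho> lam \<sigma> \<kappa>'"
    using feas pol' J by (simp add: feasible_def)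
  ultimately show False
    using opt by (auto simp: optimal_policy_def is_arg_max_def)
qed

text \<open>At the first state \<open>N\<close> with value other than 1, if \<open>N < T\<close>,
  the value is below 1 and \<open>N >= 1\<close>, so the next value is 0; being below 1 itself, it
  passes 0 on to its successor.\<close>

lemma threshold_structureI:
  assumes pol: "\<kappa> \<in> policies T" and "\<kappa> 0 = 1"
    and adj: "\<And>i. 1 \<le> i \<Longrightarrow> i < T \<Longrightarrow> \<kappa> i < 1 \<Longrightarrow> \<kappa> (Suc i) = 0"
  shows "threshold_structure T \<kappa>"
proof -
  have bounds: "0 \<le> \<kappa> j" "\<kappa> j \<le> 1" if "j \<le> T" for j
    using pol that by (auto simp: policies_def)
  \<comment> \<open>The alternative \<open>n = T\<close> makes the minimum exist and bounds it by
    \<open>T\<close>; the all-ones policy gets \<open>N = T\<close>.\<close>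
  define N where "N = (LEAST n. n = T \<or> \<kappa> n \<noteq> 1)"
  have N: "N = T \<or> \<kappa> N \<noteq> 1"
    unfolding N_def by (rule LeastI[of _ T]) simp
  have "N \<le> T"
    unfolding N_def by (rule Least_le) simp
  have ones: "\<kappa> j = 1" if "j < N" for j
    using not_less_Least[OF that[unfolded N_def]] by simp
  have zeros: "\<kappa> j = 0" if "N < j" "j \<le> T" for j
  proof -
    from that N have "\<kappa> N < 1" "1 \<le> N"
      using bounds[of N] \<open>\<kappa> 0 = 1\<close> by (cases "N = 0"; force)+
    from \<open>N < j\<close> have "Suc N \<le> j" by simp
    then show ?thesis
      using \<open>j \<le> T\<close>
    proof (induction j rule: dec_induct)
      case base
      then show ?case
        using adj[of N] \<open>\<kappa> N < 1\<close> \<open>1 \<le> N\<close> by simp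
    next
      case (step n)
      then show ?case
        using adj[of n] by simp
    qed
  qed
  show ?thesis
    unfolding threshold_structure_def
    using \<open>N \<le> T\<close> ones zeros bounds[of N]
    by (intro exI[of _ N] exI[of _ "T - N"] exI[of _ "\<kappa> N"]) auto
qed

text \<open>The two adjacent states that violate threshold form leave slack in the failure
  probabilities: the first is below its maximum, the second above \<rho>. This is the room that
  \<open>exchange_adjacent\<close> requires.\<close>

lemma longer_cycle_same_cost:
  assumes pol: "\<kappa> \<in> policies T" and "\<kappa> 0 = 1" and "\<not> threshold_structure T \<kappa>"
  obtains \<kappa>' where "\<kappa>' \<in> policies T" "\<kappa>' 0 = 1" "J \<kappa>' = J \<kappa>" "D \<kappa> < D \<kappa>'"
proof -
  define c where "c = (1 - \<rho>) * lam"
  have c: "c > 0"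
    unfolding c_def using \<rho> lam by simp
  have "(1 - \<rho>) * lam \<le> (1 - \<rho>) * 1"
    using \<rho> lam by (intro mult_left_mono) auto
  then have c1: "\<rho> + c \<le> 1"
    by (simp add: c_def)
  have bounds: "0 \<le> \<kappa> j" "\<kappa> j \<le> 1" if "j \<le> T" for j
    using pol that by (auto simp: policies_def)
  obtain i where i: "1 \<le> i" "i < T" "\<kappa> i < 1" "\<kappa> (Suc i) \<noteq> 0"
    using threshold_structureI[OF pol \<open>\<kappa> 0 = 1\<close>] assms(3) by blast
  have "0 < \<kappa> (Suc i)"
    using bounds[of "Suc i"] i by simp
  \<comment> \<open>The value 1 beyond \<open>T\<close> gives positivity at every index, although
    \<kappa> is unconstrained there.\<close>
  define s where "s j = (if j \<le> T then r \<kappa> j else 1)" for j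
  have prod_s: "(\<Prod>j = 1..t. s j) = run \<kappa> t" if "t \<le> T" for t
    using that by (intro prod.cong) (auto simp: s_def)
  have "0 < s j" for j
    using fail_prob_bounds(1)[OF pol, of j] \<rho> by (cases "j \<le> T") (auto simp: s_def)
  moreover have "s j \<le> 1" for j
    using fail_prob_bounds(3)[OF pol] by (simp add: s_def)
  moreover have "s i < \<rho> + c" "\<rho> < s (Suc i)"
    using i c \<open>0 < \<kappa> (Suc i)\<close> by (auto simp: s_def fail_prob_def c_def[symmetric])
  moreover have "0 < (1 - \<alpha>) / \<alpha>"
    using \<alpha> by simp
  ultimately obtain s' where s': "\<And>j. j \<noteq> i \<Longrightarrow> j \<noteq> Suc i \<Longrightarrow> s' j = s j"
      "s i \<le> s' i" "s' i \<le> \<rho> + c" "\<rho> \<le> s' (Suc i)" "s' (Suc i) \<le> s (Suc i)"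
      "(\<Sum>t<T. \<Prod>j = 1..t. s j) < (\<Sum>t<T. \<Prod>j = 1..t. s' j)"
      "(1 - (\<Prod>j = 1..T. s' j)) / ((1 - \<alpha>) / \<alpha> + (\<Sum>t<T. \<Prod>j = 1..t. s' j)) =
       (1 - (\<Prod>j = 1..T. s j)) / ((1 - \<alpha>) / \<alpha> + (\<Sum>t<T. \<Prod>j = 1..t. s j))"
    using exchange_adjacent[of s T i "\<rho> + c" \<rho> "(1 - \<alpha>) / \<alpha>"] i c1 by blast
  \<comment> \<open>Inverts the affine map from transmission to failure probability, which takes
    [0,1] onto [\<rho>, \<rho> + c].\<close>
  define \<kappa>' where "\<kappa>' j = (s' j - \<rho>) / c" for j
  have r': "r \<kappa>' j = s' j" for j
    using c by (simp add: fail_prob_def \<kappa>'_def c_def[symmetric])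
  have same: "\<kappa>' j = \<kappa> j" if "j \<noteq> i" "j \<noteq> Suc i" "j \<le> T" for j
    using c that s'(1) by (simp add: \<kappa>'_def s_def fail_prob_def c_def[symmetric])
  have range: "\<rho> \<le> s' j \<and> s' j \<le> \<rho> + c" if "j \<le> T" for j
    using that s'(1)[of j] s'(2-5) fail_prob_bounds(1,2)[OF pol that]
      fail_prob_bounds(1,2)[OF pol, of i] fail_prob_bounds(1,2)[OF pol, of "Suc i"] i
    by (cases "j = i"; cases "j = Suc i") (auto simp: s_def c_def)
  then have pol': "\<kappa>' \<in> policies T"
    using c by (auto simp: policies_def \<kappa>'_def field_simps)
  have sum_s: "(\<Sum>t<T. \<Prod>j = 1..t. s j) = (\<Sum>t<T. run \<kappa> t)"
    by (intro sum.cong refl prod_s) auto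
  have "\<kappa>' 0 = 1"
    using same[of 0] i \<open>\<kappa> 0 = 1\<close> by simp
  moreover have "J \<kappa>' = J \<kappa>"
    unfolding primary_cost_eq[OF pol] primary_cost_eq[OF pol'] r'
    using s'(7) unfolding sum_s prod_s[OF order_refl] by simp
  moreover have "D \<kappa> < D \<kappa>'"
    unfolding mean_cycle_eq r' using s'(6) \<alpha> unfolding sum_s by simp
  ultimately show ?thesis
    using pol' that by blast
qed

text \<open>With \<open>\<kappa> 0 = 1\<close> the only term containing \<open>D\<close> is -(1 -
  \<alpha>) (1/lam - 1) / D. A longer cycle reduces this loss, unless \<open>lam = 1\<close> makes
  the coefficient vanish.\<close>

lemma secondary_throughput_mono:
  assumes pol: "\<kappa> \<in> policies T" "\<kappa>' \<in> policies T" and "\<kappa> 0 = 1" "\<kappa>' 0 = 1"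
    and J: "J \<kappa>' = J \<kappa>" and D: "D \<kappa> < D \<kappa>'"
  shows "W \<kappa> \<le> W \<kappa>'" "lam < 1 \<Longrightarrow> W \<kappa> < W \<kappa>'"
proof -
  have pos: "0 < D \<kappa>"
    using mean_cycle_pos[OF pol(1)] .
  define u where "u = (1 - \<alpha>) * (1 / lam - 1)"
  have "W \<kappa>' - W \<kappa> = u * (1 / D \<kappa> - 1 / D \<kappa>')"
    unfolding secondary_throughput_eq[OF pol(1)] secondary_throughput_eq[OF pol(2)] J assms(3,4) u_def
    by (simp add: algebra_simps diff_divide_distrib add_divide_distrib)
  moreover have "0 < 1 / D \<kappa> - 1 / D \<kappa>'"
    using pos D by (simp add: frac_less2)
  moreover have "0 \<le> u" "lam < 1 \<Longrightarrow> 0 < u"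
    unfolding u_def using \<alpha> lam by auto
  ultimately show "W \<kappa> \<le> W \<kappa>'" "lam < 1 \<Longrightarrow> W \<kappa> < W \<kappa>'"
    by (metis diff_ge_0_iff_ge less_imp_le mult_nonneg_nonneg,
        metis diff_gt_0_iff_gt mult_pos_pos)
qed

section \<open>Existence of an optimal policy with the longest cycle\<close>

text \<open>
  Policies live on all of \<open>nat\<close>; setting them to \<open>0\<close> beyond \<open>T\<close> makes the feasible set compact
  in the product topology.
\<close>
lemma compact_feasible:
  "compact {\<kappa>. feasible T \<alpha> \<rho> lam \<sigma> \<kappa> \<and> (\<forall>j>T. \<kappa> j = 0)}"
  "continuous_on {\<kappa>. feasible T \<alpha> \<rho> lam \<sigma> \<kappa> \<and> (\<forall>j>T. \<kappa> j = 0)} D"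
  "continuous_on {\<kappa>. feasible T \<alpha> \<rho> lam \<sigma> \<kappa> \<and> (\<forall>j>T. \<kappa> j = 0)} W"
proof -
  define K :: "(nat \<Rightarrow> real) set" where "K = (\<Pi>\<^sub>E j\<in>UNIV. if j \<le> T then {0..1} else {0})"
  define F where "F = {\<kappa>. feasible T \<alpha> \<rho> lam \<sigma> \<kappa> \<and> (\<forall>j>T. \<kappa> j = 0)}"
  have K_iff: "\<kappa> \<in> K \<longleftrightarrow> \<kappa> \<in> policies T \<and> (\<forall>j>T. \<kappa> j = 0)" for \<kappa>
  proof -
    have "\<kappa> \<in> K \<longleftrightarrow> (\<forall>j. \<kappa> j \<in> (if j \<le> T then {0..1} else {0}))"
      by (simp add: K_def PiE_iff)
    also have "\<dots> \<longleftrightarrow> (\<forall>j. (j \<le> T \<longrightarrow> \<kappa> j \<in> {0..1}) \<and> (j > T \<longrightarrow> \<kappa> j = 0))"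
      by (intro all_cong1) (simp add: not_le)
    also have "\<dots> \<longleftrightarrow> \<kappa> \<in> policies T \<and> (\<forall>j>T. \<kappa> j = 0)"
      unfolding policies_def Pi_iff all_conj_distrib by (simp add: Ball_def)
    finally show ?thesis .
  qed
  have "compactin (product_topology (\<lambda>_. euclidean) UNIV) K"
    unfolding K_def compactin_PiE by auto
  then have K: "compact K"
    by (simp add: euclidean_product_topology)
  have coord: "continuous_on K (\<lambda>\<kappa>. \<kappa> j)" for j
    by (rule continuous_on_subset[OF continuous_on_product_coordinates]) simp
  have Dpos: "D \<kappa> \<noteq> 0" if "\<kappa> \<in> K" for \<kappa>
    using mean_cycle_pos[of \<kappa>] that by (simp add: K_iff)
  have contD: "continuous_on K D"
    unfolding mean_cycle_def fail_prob_def by (intro continuous_intros coord)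
  have contJ: "continuous_on K J"
    unfolding primary_cost_def fail_prob_def
    by (intro continuous_intros coord contD) (use Dpos in blast)
  have contW: "continuous_on K W"
    unfolding secondary_throughput_def fail_prob_def
    by (intro continuous_intros coord contD) (use Dpos in blast)
  have F_eq: "F = K \<inter> J -` {.. J (\<lambda>_. 0) + \<sigma>}"
    by (auto simp: F_def K_iff feasible_def)
  have "closedin (top_of_set K) F"
    unfolding F_eq using contJ by (rule continuous_closedin_preimage) simp
  then show "compact {\<kappa>. feasible T \<alpha> \<rho> lam \<sigma> \<kappa> \<and> (\<forall>j>T. \<kappa> j = 0)}"
    using K closedin_compact unfolding F_def by blast
  have "F \<subseteq> K"
    by (simp add: F_eq)
  then show "continuous_on {\<kappa>. feasible T \<alpha> \<rho> lam \<sigma> \<kappa> \<and> (\<forall>j>T. \<kappa> j = 0)} D"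
    "continuous_on {\<kappa>. feasible T \<alpha> \<rho> lam \<sigma> \<kappa> \<and> (\<forall>j>T. \<kappa> j = 0)} W"
    using contD contW continuous_on_subset unfolding F_def by blast+
qed

lemma optimal_policy_longest_cycle_exists:
  assumes "\<sigma> \<ge> 0"
  obtains \<kappa> where "optimal_policy T \<alpha> \<rho> lam \<sigma> \<kappa>"
    "\<And>\<kappa>'. optimal_policy T \<alpha> \<rho> lam \<sigma> \<kappa>' \<Longrightarrow> D \<kappa>' \<le> D \<kappa>"
proof -
  define F where "F = {\<kappa>. feasible T \<alpha> \<rho> lam \<sigma> \<kappa> \<and> (\<forall>j>T. \<kappa> j = 0)}"
  have "(\<lambda>_. 0) \<in> F"
    using assms by (auto simp: F_def feasible_def policies_def)
  then have "F \<noteq> {}"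
    by blast
  then obtain \<kappa> where \<kappa>: "\<kappa> \<in> F" "\<And>\<kappa>'. \<kappa>' \<in> F \<Longrightarrow> W \<kappa>' \<le> W \<kappa>"
      "\<And>\<kappa>'. \<kappa>' \<in> F \<Longrightarrow> W \<kappa>' = W \<kappa> \<Longrightarrow> D \<kappa>' \<le> D \<kappa>"
    using lexicographic_maximum_exists[of F W D] compact_feasible[of \<sigma>, folded F_def] by blast
  \<comment> \<open>Each feasible policy has a representative in \<open>F\<close> with the same
    \<open>W\<close> and \<open>D\<close>, so maximality within \<open>F\<close> carries over to all
    feasible policies.\<close>
  have trunc: "\<exists>\<kappa>''\<in>F. W \<kappa>'' = W \<kappa>' \<and> D \<kappa>'' = D \<kappa>'" if "feasible T \<alpha> \<rho> lam \<sigma> \<kappa>'" for \<kappa>'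
  proof -
    define \<kappa>'' where "\<kappa>'' j = (if j \<le> T then \<kappa>' j else 0)" for j
    have "\<kappa>'' j = \<kappa>' j" if "j \<le> T" for j
      using that by (simp add: \<kappa>''_def)
    note cong = policy_cong[of \<kappa>'' \<kappa>', OF this]
    have "\<kappa>'' \<in> F"
      using that cong(4)[of \<sigma>] by (simp add: F_def) (simp add: \<kappa>''_def)
    with cong show ?thesis by blast
  qed
  have feas: "feasible T \<alpha> \<rho> lam \<sigma> \<kappa>"
    using \<kappa>(1) by (simp add: F_def)
  have max: "W \<kappa>' \<le> W \<kappa>" if "feasible T \<alpha> \<rho> lam \<sigma> \<kappa>'" for \<kappa>'
    using trunc[OF that] \<kappa>(2) by force
  show ?thesis
  proof (rule that)
    show "optimal_policy T \<alpha> \<rho> lam \<sigma> \<kappa>"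
      using feas max by (auto simp: optimal_policy_def is_arg_max_def not_less)
    fix \<kappa>' assume "optimal_policy T \<alpha> \<rho> lam \<sigma> \<kappa>'"
    then have "feasible T \<alpha> \<rho> lam \<sigma> \<kappa>'" "W \<kappa> \<le> W \<kappa>'"
      using feas by (auto simp: optimal_policy_def is_arg_max_def not_less)
    with max[of \<kappa>'] trunc[of \<kappa>'] \<kappa>(3) show "D \<kappa>' \<le> D \<kappa>"
      by force
  qed
qed

section \<open>Optimal policies and threshold form\<close>

text \<open>The policy from \<open>longer_cycle_same_cost\<close> is feasible. A strict gain in
  throughput would contradict optimality, which excludes \<open>lam < 1\<close>; the weak gain makes
  the new policy optimal too.\<close>

lemma optimal_policy_improve:
  assumes opt: "optimal_policy T \<alpha> \<rho> lam \<sigma> \<kappa>" and "\<not> threshold_structure T \<kappa>"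
  shows "lam = 1" and "\<exists>\<kappa>'. optimal_policy T \<alpha> \<rho> lam \<sigma> \<kappa>' \<and> D \<kappa> < D \<kappa>'"
proof -
  have feas: "feasible T \<alpha> \<rho> lam \<sigma> \<kappa>" and pol: "\<kappa> \<in> policies T"
    and max: "\<And>\<kappa>'. feasible T \<alpha> \<rho> lam \<sigma> \<kappa>' \<Longrightarrow> W \<kappa>' \<le> W \<kappa>"
    using opt by (auto simp: optimal_policy_def is_arg_max_def feasible_def not_less)
  note idle = optimal_policy_idle[OF opt]
  obtain \<kappa>' where \<kappa>': "\<kappa>' \<in> policies T" "\<kappa>' 0 = 1" "J \<kappa>' = J \<kappa>" "D \<kappa> < D \<kappa>'"
    using longer_cycle_same_cost[OF pol idle assms(2)] .
  have feas': "feasible T \<alpha> \<rho> lam \<sigma> \<kappa>'"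
    using feas \<kappa>' by (simp add: feasible_def)
  note mono = secondary_throughput_mono[OF pol \<kappa>'(1) idle \<kappa>'(2,3,4)]
  show "lam = 1"
    using mono(2) max[OF feas'] lam by force
  have "optimal_policy T \<alpha> \<rho> lam \<sigma> \<kappa>'"
    using mono(1) max feas' by (force simp: optimal_policy_def is_arg_max_def)
  with \<kappa>'(4) show "\<exists>\<kappa>'. optimal_policy T \<alpha> \<rho> lam \<sigma> \<kappa>' \<and> D \<kappa> < D \<kappa>'"
    by blast
qed

end

text \<open>At \<open>lam = 1\<close> and \<open>\<kappa> 0 = 1\<close> the throughput depends on
  the cost alone, so feasible policies of equal cost tie; hence existence in general, and the form
  of every optimal policy only for \<open>lam < 1\<close>.\<close>

theorem theorem5:
  fixes T :: nat and \<alpha> \<rho> lam \<sigma> :: real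
  assumes "T \<ge> 1"
    and "0 < \<alpha>" and "\<alpha> < 1"
    and "0 < \<rho>" and "\<rho> < 1"
    and "0 < lam" and "lam \<le> 1"
    and "\<sigma> \<ge> 0"
  shows "(\<exists>\<kappa>. optimal_policy T \<alpha> \<rho> lam \<sigma> \<kappa> \<and> threshold_structure T \<kappa>) \<and>
         (lam < 1 \<longrightarrow>
            (\<forall>\<kappa>. optimal_policy T \<alpha> \<rho> lam \<sigma> \<kappa> \<longrightarrow> threshold_structure T \<kappa>))"
proof (intro conjI impI allI)
  note params = assms(1-7)
  obtain \<kappa> where \<kappa>: "optimal_policy T \<alpha> \<rho> lam \<sigma> \<kappa>"
      "\<And>\<kappa>'. optimal_policy T \<alpha> \<rho> lam \<sigma> \<kappa>' \<Longrightarrow>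
        mean_cycle T \<alpha> \<rho> lam \<kappa>' \<le> mean_cycle T \<alpha> \<rho> lam \<kappa>"
    using optimal_policy_longest_cycle_exists[OF params assms(8)] by blast
  then have "threshold_structure T \<kappa>"
    using optimal_policy_improve(2)[OF params \<kappa>(1)] by force
  with \<kappa>(1) show "\<exists>\<kappa>. optimal_policy T \<alpha> \<rho> lam \<sigma> \<kappa> \<and> threshold_structure T \<kappa>"
    by blast
next
  fix \<kappa> assume "lam < 1" "optimal_policy T \<alpha> \<rho> lam \<sigma> \<kappa>"
  then show "threshold_structure T \<kappa>"
    using optimal_policy_improve(1)[OF assms(1-7)] by force
qed

end
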